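(* Let $K$ be a separable metric space and $f:K\to\mathbb C$ a bounded function. There exists a countable ordinal $\alpha$ such that $\operatorname{osc}_\alpha f=\operatorname{osc}_\beta f$ for all countable ordinals $\beta>\alpha$. Letting $\tau$ be the least such $\alpha$, $f$ is in $D(K)$ if and only if $\operatorname{osc}_\tau f$ is bounded. When $f$ is real-valued and this occurs, then $$\|f\|_D=\bigl\|\,|f|+\operatorname{osc}_\tau f\,\bigr\|_\infty .$$ Moreover (in this case), setting $\lambda=\bigl\|\,|f|+\operatorname{osc}_\tau f\,\bigr\|_\infty$, $$u=\frac{\lambda-\operatorname{osc}_\tau f+f}{2}\quad\text{and}\quad v=\frac{\lambda-\operatorname{osc}_\tau f-f}{2},$$ $u$ and $v$ are non-negative lower semi-continuous functions with $f=u-v$ and $\|f\|_D=\|u+v\|_\infty$.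
   Context: $D(K)$ is the set of functions $f:K\to\mathbb C$ for which there exist continuous complex-valued functions $\varphi_1,\varphi_2,\dots$ on $K$ with $\sup_{k\in K}\sum_j|\varphi_j(k)|<\infty$ and $f=\sum_j\varphi_j$ pointwise. For $f\in D(K)$, $\|f\|_D$ is the infimum of $\sup_{k\in K}\sum_{j=1}^\infty|\varphi_j(k)|$ over all sequences $(\varphi_j)$ of bounded continuous functions on $K$ with $f=\sum\varphi_j$ pointwise. $\|\cdot\|_\infty$ is the supremum norm. All upper limits are non-exclusive: $\overline{\lim}_{y\to x}g(y)=\inf_{V}\sup_{y\in V}g(y)$, the infimum over all open neighborhoods $V$ of $x$ (so $y=x$ is allowed). For an extended real-valued function $g$ on $K$, its upper semi-continuous envelope is $Ug(x)=\overline{\lim}_{y\to x}g(y)$. The transfinite oscillations of $f:K\to\mathbb C$ are defined by induction over countable ordinals: $\operatorname{osc}_0f\equiv0$. If $\beta=\alpha+1$, set $\widetilde{\operatorname{osc}}_\beta f(x)=\overline{\lim}_{y\to x}\bigl(|f(y)-f(x)|+\operatorname{osc}_\alpha f(y)\bigr)$ for all $x\in K$. If $\beta$ is a limit ordinal, set $\widetilde{\operatorname{osc}}_\beta f=\sup_{\alpha<\beta}\operatorname{osc}_\alpha f$. In both cases $\operatorname{osc}_\beta f=U\,\widetilde{\operatorname{osc}}_\beta f$. These are $[0,\infty]$-valued functions. *)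

theory Defs
  imports "HOL-Analysis.Analysis" "HOL-Library.Countable_Set_Type"
begin

text \<open>
  The countable ordinals, realised as the field of the cardinal successor of \<open>natLeq\<close>, i.e. of
  the initial ordinal \<open>\<omega>\<^sub>1\<close>.  Up to order isomorphism this is the only uncountable well-order
  all of whose proper initial segments are countable; both properties are proved below.
\<close>

typedef countable_ord = "Field (cardSuc natLeq)"
  using Card_order_iff_ordLeq_card_of Field_cardSuc_not_empty natLeq_Card_order by blast

lemma wo_omega1: "Well_order (cardSuc natLeq)"
  using cardSuc_Card_order[OF natLeq_Card_order] by (simp add: card_order_on_def)

instantiation countable_ord :: wellorder
begin

definition less_eq_countable_ord :: "countable_ord \<Rightarrow> countable_ord \<Rightarrow> bool" where
  "\<alpha> \<le> \<beta> \<longleftrightarrow> (Rep_countable_ord \<alpha>, Rep_countable_ord \<beta>) \<in> cardSuc natLeq"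

definition less_countable_ord :: "countable_ord \<Rightarrow> countable_ord \<Rightarrow> bool" where
  "(\<alpha> :: countable_ord) < \<beta> \<longleftrightarrow> \<alpha> \<le> \<beta> \<and> \<not> \<beta> \<le> \<alpha>"

instance
proof -
  let ?r = "cardSuc natLeq"
  note defs = less_eq_countable_ord_def less_countable_ord_def
  have lin: "Linear_order ?r" and wf: "wf (?r - Id)"
    using wo_omega1 by (auto simp: well_order_on_def)
  then have R: "Refl ?r" "trans ?r" "antisym ?r" "Total ?r"
    by (auto simp: order_on_defs)
  have refl: "\<alpha> \<le> \<alpha>" for \<alpha> :: countable_ord
    using R(1) Rep_countable_ord[of \<alpha>] by (auto simp: defs refl_on_def)
  have antisym: "\<alpha> = \<beta>" if "\<alpha> \<le> \<beta>" "\<beta> \<le> \<alpha>" for \<alpha> \<beta> :: countable_ord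
    using R(3) that unfolding less_eq_countable_ord_def antisym_def
    by (metis Rep_countable_ord_inject)
  have less_wf: "wf {(\<alpha>, \<beta> :: countable_ord). \<alpha> < \<beta>}"
  proof (rule wf_subset[OF wf_inv_image[OF wf, of Rep_countable_ord]])
    show "{(\<alpha>, \<beta> :: countable_ord). \<alpha> < \<beta>} \<subseteq> inv_image (?r - Id) Rep_countable_ord"
      using antisym refl by (auto simp: defs inv_image_def Rep_countable_ord_inject)
  qed
  show "OFCLASS(countable_ord, wellorder_class)"
  proof
    fix \<alpha> \<beta> \<gamma> :: countable_ord
    show "(\<alpha> < \<beta>) = (\<alpha> \<le> \<beta> \<and> \<not> \<beta> \<le> \<alpha>)" by (simp add: less_countable_ord_def)
    show "\<alpha> \<le> \<alpha>" by (rule refl)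
    show "\<alpha> \<le> \<gamma>" if "\<alpha> \<le> \<beta>" "\<beta> \<le> \<gamma>"
      using that R(2) unfolding less_eq_countable_ord_def trans_def by blast
    show "\<alpha> = \<beta>" if "\<alpha> \<le> \<beta>" "\<beta> \<le> \<alpha>" using that by (rule antisym)
    show "\<alpha> \<le> \<beta> \<or> \<beta> \<le> \<alpha>"
    proof (cases "\<alpha> = \<beta>")
      case False
      then show ?thesis
        using R(4) Rep_countable_ord[of \<alpha>] Rep_countable_ord[of \<beta>]
        by (auto simp: defs total_on_def Rep_countable_ord_inject)
    qed (simp add: refl)
  next
    fix P :: "countable_ord \<Rightarrow> bool" and \<alpha>
    assume step: "\<And>\<beta>. (\<And>\<gamma>. \<gamma> < \<beta> \<Longrightarrow> P \<gamma>) \<Longrightarrow> P \<beta>"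
    show "P \<alpha>"
      by (rule wf_induct_rule[OF less_wf, of P], rule step) auto
  qed
qed

end

lemma Rep_image_countable_ord: "range Rep_countable_ord = Field (cardSuc natLeq)"
  using type_definition.Rep_range[OF type_definition_countable_ord] .

lemma uncountable_UNIV_countable_ord:
  includes cardinal_syntax
  shows "uncountable (UNIV :: countable_ord set)"
proof
  assume "countable (UNIV :: countable_ord set)"
  then have "countable (Field (cardSuc natLeq))"
    unfolding Rep_image_countable_ord[symmetric] by (rule countable_image)
  then have "|Field (cardSuc natLeq)| \<le>o natLeq"
    by (simp add: countable_card_le_natLeq)
  then have "cardSuc natLeq \<le>o natLeq"
    using card_of_Field_ordIso[OF cardSuc_Card_order[OF natLeq_Card_order]]
      ordIso_ordLeq_trans ordIso_symmetric by blast
  with cardSuc_greater[OF natLeq_Card_order] show False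
    using not_ordLess_ordLeq by blast
qed

lemma countable_lessThan_countable_ord:
  includes cardinal_syntax
  shows "countable {..<\<alpha> :: countable_ord}"
proof -
  let ?r = "cardSuc natLeq"
  have "|underS ?r (Rep_countable_ord \<alpha>)| <o ?r"
    by (rule card_of_underS[OF cardSuc_Card_order[OF natLeq_Card_order] Rep_countable_ord])
  then have "countable (underS ?r (Rep_countable_ord \<alpha>))"
    using cardSuc_ordLeq_ordLess[OF natLeq_Card_order card_of_Card_order]
    by (auto simp: countable_card_le_natLeq)
  moreover have "Rep_countable_ord ` {..<\<alpha>} \<subseteq> underS ?r (Rep_countable_ord \<alpha>)"
    by (auto simp: underS_def less_le less_eq_countable_ord_def Rep_countable_ord_inject)
  ultimately have "countable (Rep_countable_ord ` {..<\<alpha>})"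
    using countable_subset by blast
  then show ?thesis
    by (rule countable_image_inj_on) (auto simp: inj_on_def Rep_countable_ord_inject)
qed

instantiation countable_ord :: zero
begin
definition zero_countable_ord :: countable_ord where "(0 :: countable_ord) = (LEAST \<alpha>. True)"
instance ..
end

lemma zero_le_countable_ord [simp]: "0 \<le> (\<alpha> :: countable_ord)"
  unfolding zero_countable_ord_def by (rule Least_le) simp

definition osuc :: "countable_ord \<Rightarrow> countable_ord" where
  "osuc \<alpha> = (LEAST \<beta>. \<alpha> < \<beta>)"

lemma less_osuc [simp]: "\<alpha> < osuc \<alpha>"
proof -
  have "\<exists>\<beta>. \<alpha> < \<beta>"
  proof (rule ccontr)
    assume "\<nexists>\<beta>. \<alpha> < \<beta>"
    then have "(UNIV :: countable_ord set) = insert \<alpha> {..<\<alpha>}"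
      by (auto simp: not_less order.order_iff_strict)
    then have "countable (UNIV :: countable_ord set)"
      using countable_insert[OF countable_lessThan_countable_ord] by metis
    then show False using uncountable_UNIV_countable_ord by blast
  qed
  then show ?thesis unfolding osuc_def by (rule LeastI_ex)
qed

lemma osuc_le_iff: "osuc \<alpha> \<le> \<beta> \<longleftrightarrow> \<alpha> < \<beta>"
  using less_osuc[of \<alpha>] by (metis Least_le order.strict_trans2 osuc_def)

lemma osuc_inject [simp]: "osuc \<alpha> = osuc \<beta> \<longleftrightarrow> \<alpha> = \<beta>"
  by (metis less_osuc linorder_neq_iff osuc_le_iff leD)

lemma osuc_neq_zero [simp]: "osuc \<alpha> \<noteq> 0"
  by (metis less_osuc not_less zero_le_countable_ord)

text \<open>The non-exclusive upper limit: the neighbourhoods are not punctured.\<close>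

definition upper_lim :: "'a::topological_space \<Rightarrow> ('a \<Rightarrow> 'b::complete_lattice) \<Rightarrow> 'b" where
  "upper_lim x g = (INF V\<in>{V. open V \<and> x \<in> V}. SUP y\<in>V. g y)"

lemma upper_lim_eq_Limsup: "upper_lim x g = Limsup (nhds x) g"
  unfolding upper_lim_def Limsup_def
proof (rule antisym)
  show "(INF V\<in>{V. open V \<and> x \<in> V}. SUP y\<in>V. g y)
      \<le> (INF P\<in>{P. eventually P (nhds x)}. SUP y\<in>{y. P y}. g y)"
  proof (rule INF_greatest, clarsimp)
    fix P assume "eventually P (nhds x)"
    then obtain V where V: "open V" "x \<in> V" "\<forall>y\<in>V. P y"
      by (auto simp: eventually_nhds)
    then show "(INF V\<in>{V. open V \<and> x \<in> V}. SUP y\<in>V. g y) \<le> (SUP y\<in>Collect P. g y)"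
      by (intro INF_lower2[of V] SUP_subset_mono) auto
  qed
  show "(INF P\<in>{P. eventually P (nhds x)}. SUP y\<in>{y. P y}. g y)
      \<le> (INF V\<in>{V. open V \<and> x \<in> V}. SUP y\<in>V. g y)"
  proof (rule INF_greatest, clarsimp)
    fix V assume "open V" "x \<in> V"
    then show "(INF P\<in>{P. eventually P (nhds x)}. SUP y\<in>Collect P. g y) \<le> (SUP y\<in>V. g y)"
      by (intro INF_lower2[of "\<lambda>y. y \<in> V"]) (auto simp: eventually_nhds)
  qed
qed

definition usc_env :: "('a::topological_space \<Rightarrow> 'b::complete_lattice) \<Rightarrow> 'a \<Rightarrow> 'b" where
  "usc_env g x = upper_lim x g"

text \<open>
  The transfinite oscillations.  The recursion equations at zero, at successors and at limits
  are \<open>osc_zero\<close>, \<open>osc_osuc\<close> and \<open>osc_limit\<close> below.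
\<close>

function osc :: "('a::topological_space \<Rightarrow> complex) \<Rightarrow> countable_ord \<Rightarrow> 'a \<Rightarrow> ennreal" where
  "osc f \<beta> =
    (if \<beta> = 0 then (\<lambda>x. 0)
     else if \<exists>\<alpha>. \<beta> = osuc \<alpha> then
       usc_env (\<lambda>x. upper_lim x (\<lambda>y. ennreal (norm (f y - f x)) + osc f (THE \<alpha>. \<beta> = osuc \<alpha>) y))
     else usc_env (\<lambda>x. SUP \<alpha>\<in>{..<\<beta>}. osc f \<alpha> x))"
  by auto
termination
  by (relation "inv_image {(\<alpha>, \<beta>). \<alpha> < \<beta>} snd") (auto intro: wf_inv_image wf)

declare osc.simps [simp del]

lemma osc_zero: "osc f 0 = (\<lambda>x. 0)"
  by (simp add: osc.simps)

lemma osc_osuc: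
  "osc f (osuc \<alpha>) =
    usc_env (\<lambda>x. upper_lim x (\<lambda>y. ennreal (norm (f y - f x)) + osc f \<alpha> y))"
  by (subst osc.simps) simp

lemma osc_limit:
  assumes "\<beta> \<noteq> 0" "\<nexists>\<alpha>. \<beta> = osuc \<alpha>"
  shows "osc f \<beta> = usc_env (\<lambda>x. SUP \<alpha>\<in>{..<\<beta>}. osc f \<alpha> x)"
  using assms by (subst osc.simps) simp

definition D_space :: "('a::topological_space \<Rightarrow> complex) set" where
  "D_space = {f. \<exists>\<phi> :: nat \<Rightarrow> 'a \<Rightarrow> complex.
     (\<forall>j. continuous_on UNIV (\<phi> j)) \<and>
     (SUP k. \<Sum>j. ennreal (norm (\<phi> j k))) < \<infinity> \<and>
     (\<forall>k. (\<lambda>j. \<phi> j k) sums f k)}"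

definition D_norm :: "('a::topological_space \<Rightarrow> complex) \<Rightarrow> ennreal" where
  "D_norm f = (INF \<phi>\<in>{\<phi> :: nat \<Rightarrow> 'a \<Rightarrow> complex.
      (\<forall>j. continuous_on UNIV (\<phi> j) \<and> bounded (range (\<phi> j))) \<and>
      (\<forall>k. (\<lambda>j. \<phi> j k) sums f k)}. SUP k. \<Sum>j. ennreal (norm (\<phi> j k)))"

definition lower_semicontinuous :: "('a::topological_space \<Rightarrow> real) \<Rightarrow> bool" where
  "lower_semicontinuous g \<longleftrightarrow> (\<forall>c. open {x. c < g x})"

end

theory Submission
  imports Defs
begin

text \<open>
  If \<open>f = \<Sum>\<phi>\<^sub>j\<close> with \<open>W = \<Sum>|\<phi>\<^sub>j|\<close> bounded by \<open>M\<close>, then \<open>V = M - W\<close> satisfies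
  \<open>limsup (|f y - f x| + V y) \<le> V x\<close> as \<open>y\<close> tends to \<open>x\<close>, because the tail of the series at \<open>y\<close>
  is controlled by the jump of \<open>W\<close>.  Every function with this property dominates all the
  oscillations, whence \<open>|f| + osc\<^sub>\<alpha> f \<le> W + V = M\<close>.

  Conversely, a stable finite oscillation itself has this property, which makes \<open>osc\<^sub>\<tau> f \<plusminus> f\<close>
  (for real \<open>f\<close>; for complex \<open>f\<close> use the real and imaginary part) upper semicontinuous.  So \<open>u\<close>
  and \<open>v\<close> are nonnegative and lower semicontinuous, hence sums of nonnegative continuous functions,
  obtained by the inf-convolutions \<open>inf\<^sub>y (u y + n dist x y)\<close>.
\<close>

section \<open>Upper limits and envelopes\<close>

lemma upper_lim_le_iff:
  fixes g :: "'a::topological_space \<Rightarrow> 'b::complete_linorder"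
  shows "upper_lim x g \<le> c \<longleftrightarrow> (\<forall>t>c. \<forall>\<^sub>F y in nhds x. g y < t)"
  unfolding upper_lim_eq_Limsup by (rule Limsup_le_iff)

lemma upper_lim_mono: "(\<And>y. g y \<le> h y) \<Longrightarrow> upper_lim x g \<le> upper_lim x h"
  unfolding upper_lim_eq_Limsup by (rule Limsup_mono) simp

lemma upper_lim_ge: "g x \<le> upper_lim x g"
  unfolding upper_lim_def by (rule INF_greatest) (auto intro: SUP_upper)

lemma usc_env_ge: "g x \<le> usc_env g x"
  unfolding usc_env_def by (rule upper_lim_ge)

text \<open>Minimality of the envelope among upper semicontinuous majorants. Upper semicontinuity is
  expressed as \<open>upper_lim x h \<le> h x\<close>; the reverse inequality is
  \<open>upper_lim_ge\<close>.\<close>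

lemma usc_env_le:
  assumes "\<And>x. g x \<le> h x" "\<And>x. upper_lim x h \<le> h x"
  shows "usc_env g x \<le> h x"
  unfolding usc_env_def using upper_lim_mono[of g h x] assms order_trans by blast

text \<open>An open neighbourhood of \<open>x\<close> is also a neighbourhood of each of its points,
  so the supremum of \<open>g\<close> over it bounds the envelope on all of it.\<close>

lemma upper_lim_usc_env: "upper_lim x (usc_env g) \<le> usc_env g x"
proof -
  have "upper_lim x (usc_env g) \<le> (SUP y\<in>V. g y)" if V: "open V" "x \<in> V" for V
  proof -
    have "usc_env g y \<le> (SUP y\<in>V. g y)" if "y \<in> V" for y
      unfolding usc_env_def upper_lim_def using V(1) that by (intro INF_lower) auto
    then have "(SUP y\<in>V. usc_env g y) \<le> (SUP y\<in>V. g y)"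
      by (rule SUP_least)
    then show ?thesis
      unfolding upper_lim_def using V by (intro INF_lower2[of V]) auto
  qed
  then show ?thesis
    unfolding usc_env_def[of g x] upper_lim_def[of x g] by (auto intro: INF_greatest)
qed

section \<open>Transfinite oscillations\<close>

lemma countable_ord_cases [case_names zero osuc limit]:
  fixes \<beta> :: countable_ord
  obtains "\<beta> = 0" | \<alpha> where "\<beta> = osuc \<alpha>" | "\<beta> \<noteq> 0" "\<nexists>\<alpha>. \<beta> = osuc \<alpha>"
  by blast

lemma upper_lim_osc: "upper_lim x (osc f \<beta>) \<le> osc f \<beta> x"
proof (cases \<beta> rule: countable_ord_cases)
  case zero
  then show ?thesis
    by (simp add: osc_zero upper_lim_le_iff del: le_zero_eq)
qed (simp_all add: osc_osuc osc_limit upper_lim_usc_env)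

lemma osc_osuc_ge:
  "upper_lim x (\<lambda>y. ennreal (norm (f y - f x)) + osc f \<alpha> y) \<le> osc f (osuc \<alpha>) x"
  unfolding osc_osuc by (rule usc_env_ge)

lemma osc_le_osuc: "osc f \<alpha> x \<le> osc f (osuc \<alpha>) x"
proof -
  have "osc f \<alpha> x = ennreal (norm (f x - f x)) + osc f \<alpha> x" by simp
  also have "\<dots> \<le> upper_lim x (\<lambda>y. ennreal (norm (f y - f x)) + osc f \<alpha> y)"
    by (rule upper_lim_ge)
  also have "\<dots> \<le> osc f (osuc \<alpha>) x"
    by (rule osc_osuc_ge)
  finally show ?thesis .
qed

lemma less_osuc_iff: "\<alpha> < osuc \<beta> \<longleftrightarrow> \<alpha> \<le> \<beta>"
  by (metis less_osuc not_le order.strict_trans1 osuc_le_iff)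

lemma osc_mono: "\<alpha> \<le> \<beta> \<Longrightarrow> osc f \<alpha> x \<le> osc f \<beta> x"
proof (induction \<beta> arbitrary: \<alpha> rule: less_induct)
  case (less \<beta>)
  show ?case
  proof (cases "\<alpha> = \<beta>")
    case False
    with less.prems have lt: "\<alpha> < \<beta>" by simp
    show ?thesis
    proof (cases \<beta> rule: countable_ord_cases)
      case zero
      with lt show ?thesis by (metis leD zero_le_countable_ord)
    next
      case (osuc \<gamma>)
      with lt have "osc f \<alpha> x \<le> osc f \<gamma> x"
        by (intro less.IH) (auto simp: less_osuc_iff)
      with osuc show ?thesis
        using osc_le_osuc order_trans by blast
    next
      case limit
      have "osc f \<alpha> x \<le> (SUP \<alpha>\<in>{..<\<beta>}. osc f \<alpha> x)"
        using lt by (intro SUP_upper) simp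
      also have "\<dots> \<le> osc f \<beta> x"
        unfolding osc_limit[OF limit] by (rule usc_env_ge)
      finally show ?thesis .
    qed
  qed simp
qed

text \<open>The hypothesis makes \<open>V\<close> a supersolution of the successor step. Dropping
  the increment of \<open>f\<close> shows that \<open>V\<close> is upper semicontinuous, so the
  envelopes taken at successors and limits stay below \<open>V\<close>.\<close>

lemma osc_le_majorant:
  assumes V: "\<And>x. upper_lim x (\<lambda>y. ennreal (norm (f y - f x)) + V y) \<le> V x"
  shows "osc f \<beta> x \<le> V x"
proof -
  have usc: "upper_lim x V \<le> V x" for x
    using V[of x] upper_lim_mono[of V "\<lambda>y. ennreal (norm (f y - f x)) + V y" x]
    by (auto intro: order_trans)
  show ?thesis
  proof (induction \<beta> arbitrary: x rule: less_induct)
    case (less \<beta>)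
    show ?case
    proof (cases \<beta> rule: countable_ord_cases)
      case zero
      then show ?thesis by (simp add: osc_zero)
    next
      case (osuc \<alpha>)
      then have "osc f \<alpha> y \<le> V y" for y
        by (simp add: less.IH)
      then have "upper_lim x (\<lambda>y. ennreal (norm (f y - f x)) + osc f \<alpha> y) \<le> V x" for x
        by (intro order_trans[OF upper_lim_mono V]) (simp add: add_left_mono)
      then show ?thesis
        unfolding osuc osc_osuc by (rule usc_env_le) (rule usc)
    next
      case limit
      show ?thesis
        unfolding osc_limit[OF limit] by (rule usc_env_le) (auto intro: SUP_least less.IH usc)
    qed
  qed
qed

section \<open>Stabilization\<close>

text \<open>Without a bound, every countable ordinal would lie below a member of \<open>S\<close>,
  and the uncountable type would be a countable union of countable initial segments.\<close>

lemma countable_ord_bounded: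
  fixes S :: "countable_ord set"
  assumes "countable S"
  obtains \<alpha> where "\<And>s. s \<in> S \<Longrightarrow> s \<le> \<alpha>"
proof (rule ccontr)
  assume "\<not> thesis"
  with that have "UNIV = (\<Union>s\<in>S. {..<s})"
    by (fastforce simp: not_le)
  moreover have "countable (\<Union>s\<in>S. {..<s})"
    using assms countable_lessThan_countable_ord by (rule countable_UN)
  ultimately show False
    using uncountable_UNIV_countable_ord by simp
qed

text \<open>
  Each event \<open>\<exists>y\<in>B. q < h \<alpha> y\<close>, with \<open>B\<close> from a countable base and \<open>q\<close> rational, that ever
  occurs does so from some countable ordinal on; these events determine the \<open>h \<alpha>\<close>.
\<close>

lemma increasing_usc_stabilizes:
  fixes h :: "countable_ord \<Rightarrow> 'a::metric_space \<Rightarrow> ennreal"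
  assumes sep: "separable_space (euclidean :: 'a topology)"
    and mono: "\<And>\<alpha> \<beta> x. \<alpha> \<le> \<beta> \<Longrightarrow> h \<alpha> x \<le> h \<beta> x"
    and usc: "\<And>\<alpha> x. upper_lim x (h \<alpha>) \<le> h \<alpha> x"
  obtains \<alpha> where "\<And>\<beta>. \<alpha> \<le> \<beta> \<Longrightarrow> h \<alpha> = h \<beta>"
proof -
  obtain D :: "'a set" where D: "countable D" "closure D = UNIV"
    using sep unfolding separable_space_def by auto
  define P where "P = (\<lambda>(d, n, q) \<alpha>.
    \<exists>y\<in>ball d (inverse (real (Suc n))). ennreal (real_of_rat q) < h \<alpha> y)"
  \<comment> \<open>For an event that never occurs, \<open>LEAST\<close> is an unspecified ordinal;
    bounding it as well does no harm.\<close>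
  have "countable ((\<lambda>i. LEAST \<alpha>. P i \<alpha>) ` (D \<times> UNIV \<times> UNIV))"
    using D(1) by simp
  then obtain \<alpha> where \<alpha>: "\<And>i. i \<in> D \<times> UNIV \<times> UNIV \<Longrightarrow> (LEAST \<alpha>. P i \<alpha>) \<le> \<alpha>"
    using countable_ord_bounded by (metis (no_types, lifting) imageI)
  have "h \<beta> x \<le> h \<alpha> x" if "\<alpha> \<le> \<beta>" for \<beta> x
  proof (rule ccontr)
    assume "\<not> h \<beta> x \<le> h \<alpha> x"
    then obtain q where q: "h \<alpha> x < ennreal (real_of_rat q)" "ennreal (real_of_rat q) < h \<beta> x"
      using ennreal_rat_dense by (meson not_le)
    then have "\<forall>\<^sub>F y in nhds x. h \<alpha> y < ennreal (real_of_rat q)"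
      using usc[of x \<alpha>] by (simp add: upper_lim_le_iff)
    then obtain e where e: "e > 0" "\<And>y. dist y x < e \<Longrightarrow> h \<alpha> y < ennreal (real_of_rat q)"
      unfolding eventually_nhds_metric by blast
    \<comment> \<open>A ball of radius below \<open>e / 2\<close> that contains \<open>x\<close>
      stays within distance \<open>e\<close> of \<open>x\<close>.\<close>
    obtain n where n: "inverse (real (Suc n)) < e / 2"
      using reals_Archimedean[of "e / 2"] e(1) by auto
    obtain d where d: "d \<in> D" "dist d x < inverse (real (Suc n))"
      using D(2) closure_approachable[of x D] by (metis UNIV_I inverse_positive_iff_positive of_nat_0_less_iff zero_less_Suc)
    have sub: "dist y x < e" if "y \<in> ball d (inverse (real (Suc n)))" for y
      using that d(2) n dist_triangle[of y x d] by (simp add: dist_commute)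
    have "P (d, n, q) \<beta>"
      unfolding P_def using q(2) d(2) by auto
    \<comment> \<open>The event holds at \<open>\<beta>\<close>, hence at its first ordinal, which
      is at most \<open>\<alpha>\<close>. By monotonicity \<open>h \<alpha>\<close> then exceeds
      \<open>q\<close> at a point where it was shown to be below \<open>q\<close>.\<close>
    then have "P (d, n, q) (LEAST \<alpha>. P (d, n, q) \<alpha>)"
      by (rule LeastI)
    then obtain y where y: "y \<in> ball d (inverse (real (Suc n)))"
      "ennreal (real_of_rat q) < h (LEAST \<alpha>. P (d, n, q) \<alpha>) y"
      unfolding P_def by auto
    have "h (LEAST \<alpha>. P (d, n, q) \<alpha>) y \<le> h \<alpha> y"
      using d(1) by (intro mono \<alpha>) auto
    with y(2) e(2)[OF sub[OF y(1)]] show False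
      by (meson leD order.strict_trans2 order.strict_implies_order)
  qed
  then show ?thesis
    using mono that by (metis antisym ext)
qed

section \<open>The oscillations are bounded by the D-norm\<close>

text \<open>Stated for a single series rather than for \<open>D_norm\<close>, so that it yields both
  the lower bound on the norm and the boundedness of the oscillations on
  \<open>D_space\<close>.\<close>

lemma osc_le_sum_norm:
  fixes f :: "'a::t2_space \<Rightarrow> complex"
  assumes cont: "\<And>j. continuous_on UNIV (\<phi> j)"
    and sums: "\<And>k. (\<lambda>j. \<phi> j k) sums f k"
  shows "ennreal (norm (f x)) + osc f \<beta> x \<le> (SUP k. \<Sum>j. ennreal (norm (\<phi> j k)))"
proof -
  define S where "S = (SUP k. \<Sum>j. ennreal (norm (\<phi> j k)))"
  have "ennreal (norm (f x)) + osc f \<beta> x \<le> S"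
  proof (cases S)
    case (real M)
    note M = real(2) real(1)
    have le_M: "(\<Sum>j. ennreal (norm (\<phi> j k))) \<le> ennreal M" for k
      unfolding M(1)[symmetric] S_def by (rule SUP_upper) simp
    have sm: "summable (\<lambda>j. norm (\<phi> j k))" for k
      by (rule summable_suminf_not_top) (use le_M[of k] in \<open>auto simp: top_unique\<close>)
    define w where "w k = (\<Sum>j. norm (\<phi> j k))" for k
    have w_le: "w k \<le> M" for k
      using le_M[of k] M(2) by (simp add: suminf_ennreal2[OF _ sm] w_def)
    have f_le: "norm (f k) \<le> w k" for k
      unfolding w_def sums_unique[OF sums] by (rule summable_norm[OF sm])
    define V where "V k = ennreal (M - w k)" for k
    have key: "\<forall>\<^sub>F y in nhds x. norm (f y - f x) + (M - w y) < (M - w x) + e"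
      if "e > 0" for x e
    proof -
      have "(\<lambda>n. \<Sum>j<n. norm (\<phi> j x)) \<longlonglongrightarrow> w x"
        unfolding w_def using sm by (rule summable_LIMSEQ)
      then have "\<forall>\<^sub>F n in sequentially. (\<Sum>j<n. norm (\<phi> j x)) > w x - e / 4"
        using that by (intro order_tendstoD) auto
      then obtain n where n: "(\<Sum>j<n. norm (\<phi> j x)) > w x - e / 4"
        by (auto simp: eventually_sequentially)
      \<comment> \<open>The tail need not be small at \<open>y\<close>; the point is that its bound
        contains \<open>w y\<close>, which cancels against \<open>M - w y\<close>.\<close>
      have tail: "norm (f y - (\<Sum>j<n. \<phi> j y)) \<le> w y - (\<Sum>j<n. norm (\<phi> j y))" for y
      proof -
        have "f y - (\<Sum>j<n. \<phi> j y) = (\<Sum>j. \<phi> (j + n) y)"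
          using suminf_minus_initial_segment[OF sums_summable[OF sums[of y]], of n]
            sums_unique[OF sums[of y]] by simp
        moreover have "w y - (\<Sum>j<n. norm (\<phi> j y)) = (\<Sum>j. norm (\<phi> (j + n) y))"
          unfolding w_def by (rule suminf_minus_initial_segment[OF sm, symmetric])
        ultimately show ?thesis
          using summable_norm[OF summable_ignore_initial_segment[OF sm, of n y]] by simp
      qed
      have "isCont (\<phi> j) x" for j
        using cont by (simp add: continuous_on_eq_continuous_at)
      then have "isCont (\<lambda>y. \<Sum>j<n. norm (\<phi> j y - \<phi> j x)) x"
        by (intro continuous_intros)
      \<comment> \<open>The limit is moved from \<open>at x\<close> to \<open>nhds x\<close> because
        the upper limit includes the centre.\<close>
      then have "((\<lambda>y. \<Sum>j<n. norm (\<phi> j y - \<phi> j x)) \<longlongrightarrow> (\<Sum>j<n. norm (\<phi> j x - \<phi> j x))) (nhds x)"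
        unfolding isCont_def by (subst (asm) tendsto_at_iff_tendsto_nhds)
      then have "\<forall>\<^sub>F y in nhds x. (\<Sum>j<n. norm (\<phi> j y - \<phi> j x)) < e / 4"
        using that by (intro order_tendstoD) auto
      then show ?thesis
      proof eventually_elim
        case (elim y)
        let ?A = "\<Sum>j<n. norm (\<phi> j y - \<phi> j x)"
        let ?a = "f y - (\<Sum>j<n. \<phi> j y)" and ?b = "f x - (\<Sum>j<n. \<phi> j x)"
        have "f y - f x = (?a - ?b) + (\<Sum>j<n. \<phi> j y - \<phi> j x)"
          by (simp add: sum_subtractf)
        then have norm_eq: "norm (f y - f x) = norm ((?a - ?b) + (\<Sum>j<n. \<phi> j y - \<phi> j x))"
          by (rule arg_cong)
        \<comment> \<open>The error \<open>e\<close> is spent in quarters: \<open>?A\<close> enters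
          twice, and the tail of \<open>w\<close> at \<open>x\<close> twice, once to bound
          \<open>?b\<close> and once to replace the partial sum at \<open>x\<close> by
          \<open>w x\<close>.\<close>
        have "norm (f y - f x) \<le> norm ?a + norm ?b + ?A"
          unfolding norm_eq using norm_triangle_ineq[of "?a - ?b" "\<Sum>j<n. \<phi> j y - \<phi> j x"] norm_triangle_ineq4[of ?a ?b]
            norm_sum[of "\<lambda>j. \<phi> j y - \<phi> j x" "{..<n}"] by linarith
        moreover have "(\<Sum>j<n. norm (\<phi> j x)) \<le> (\<Sum>j<n. norm (\<phi> j y)) + ?A"
          unfolding sum.distrib[symmetric]
          by (intro sum_mono) (metis norm_minus_commute norm_triangle_sub)
        ultimately show ?case
          using tail[of y] tail[of x] n elim by linarith
      qed
    qed
    have "upper_lim x (\<lambda>y. ennreal (norm (f y - f x)) + V y) \<le> V x" for x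
    proof (unfold upper_lim_le_iff, intro allI impI)
      fix t assume t: "V x < t"
      show "\<forall>\<^sub>F y in nhds x. ennreal (norm (f y - f x)) + V y < t"
      proof (cases t)
        case (real r)
        with t have r: "r - (M - w x) > 0"
          unfolding V_def by (simp add: ennreal_less_iff w_le)
        from key[OF this, of x] show ?thesis
          by eventually_elim
            (use real w_le in \<open>simp add: V_def ennreal_plus[symmetric] ennreal_less_iff del: ennreal_plus\<close>)
      qed (simp add: V_def)
    qed
    then have "osc f \<beta> x \<le> V x"
      by (rule osc_le_majorant)
    then have "ennreal (norm (f x)) + osc f \<beta> x \<le> ennreal (w x) + V x"
      using f_le[of x] by (intro add_mono ennreal_leI)
    also have "\<dots> = ennreal M"
      unfolding V_def using w_le[of x] norm_ge_zero f_le[of x] order_trans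
      by (subst ennreal_plus[symmetric]) (auto intro: order_trans[OF norm_ge_zero])
    finally show ?thesis
      by (simp add: M(1))
  qed simp
  then show ?thesis
    unfolding S_def .
qed

lemma osc_le_D_norm:
  fixes f :: "'a::t2_space \<Rightarrow> complex"
  shows "ennreal (norm (f x)) + osc f \<beta> x \<le> D_norm f"
  unfolding D_norm_def by (rule INF_greatest, rule osc_le_sum_norm) auto

section \<open>Lower semicontinuous functions as series of continuous functions\<close>

lemma lower_semicontinuousI:
  assumes "\<And>x e. e > 0 \<Longrightarrow> \<forall>\<^sub>F y in nhds x. g x < g y + e"
  shows "lower_semicontinuous g"
proof -
  have "\<forall>\<^sub>F y in nhds x. c < g y" if "c < g x" for c x
    using assms[of "g x - c" x] that by (auto elim: eventually_mono)
  then show ?thesis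
    unfolding lower_semicontinuous_def
    by (auto simp: eventually_nhds open_subopen[of "{x. c < g x}" for c] subset_eq)
qed

text \<open>The inf-convolutions \<open>h n\<close> are Lipschitz with constant \<open>n\<close> and
  increase to \<open>g\<close>, so their consecutive differences are continuous and nonnegative and
  telescope to \<open>g\<close>.\<close>

lemma lower_semicontinuous_sums_continuous:
  fixes g :: "'a::metric_space \<Rightarrow> real"
  assumes lsc: "lower_semicontinuous g" and nonneg: "\<And>x. 0 \<le> g x"
  obtains \<phi> :: "nat \<Rightarrow> 'a \<Rightarrow> real" where "\<And>j. continuous_on UNIV (\<phi> j)"
    "\<And>j x. 0 \<le> \<phi> j x" "\<And>x. (\<lambda>j. \<phi> j x) sums g x"
proof -
  define h where "h n x = (INF y. g y + real n * dist x y)" for n x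
  have bdd: "bdd_below (range (\<lambda>y. g y + real n * dist x y))" for n x
    by (rule bdd_belowI[of _ 0]) (auto simp: nonneg)
  have h_le: "h n x \<le> g y + real n * dist x y" for n x y
    unfolding h_def by (rule cINF_lower[OF bdd]) simp
  have h_ge: "c \<le> h n x" if "\<And>y. c \<le> g y + real n * dist x y" for c n x
    unfolding h_def using that by (intro cINF_greatest) auto
  have h_nonneg: "0 \<le> h n x" for n x
    by (rule h_ge) (simp add: nonneg)
  have h_mono: "h n x \<le> h (Suc n) x" for n x
  proof (rule h_ge)
    fix y show "h n x \<le> g y + real (Suc n) * dist x y"
      by (intro order_trans[OF h_le[of n x y]] add_left_mono mult_right_mono) auto
  qed
  have h_lip: "h n x \<le> h n z + real n * dist x z" for n x z
  proof -
    have "h n x - real n * dist x z \<le> h n z"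
    proof (rule h_ge)
      fix y
      have "real n * dist x y \<le> real n * (dist x z + dist z y)"
        by (intro mult_left_mono dist_triangle) simp
      then show "h n x - real n * dist x z \<le> g y + real n * dist z y"
        using h_le[of n x y] by (simp add: algebra_simps)
    qed
    then show ?thesis by simp
  qed
  have "(real n)-lipschitz_on UNIV (h n)" for n
  proof (rule lipschitz_onI)
    fix x y
    show "dist (h n x) (h n y) \<le> real n * dist x y"
      using h_lip[of n x y] h_lip[of n y x] by (simp add: dist_real_def dist_commute abs_le_iff)
  qed simp
  then have h_cont: "continuous_on UNIV (h n)" for n
    by (rule lipschitz_on_continuous_on)
  have h_lim: "(\<lambda>n. h n x) \<longlonglongrightarrow> g x" for x
  proof (rule order_tendstoI)
    fix a assume "g x < a"
    then have "h n x < a" for n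
      using h_le[of n x x] by simp
    then show "\<forall>\<^sub>F n in sequentially. h n x < a" by simp
  next
    fix a assume a: "a < g x"
    \<comment> \<open>An infimum inherits only non-strict bounds, hence an intermediate level. Near
      \<open>x\<close> semicontinuity keeps \<open>g\<close> above \<open>b\<close>; at distance at
      least \<open>e\<close> the penalty alone exceeds \<open>b\<close> once \<open>n\<close> is at
      least \<open>N\<close>.\<close>
    obtain b where b: "a < b" "b < g x"
      using dense[OF a] by blast
    then have "open {y. b < g y}" "x \<in> {y. b < g y}"
      using lsc by (auto simp: lower_semicontinuous_def)
    then obtain e where e: "e > 0" "\<And>y. dist y x < e \<Longrightarrow> b < g y"
      unfolding open_dist by auto
    obtain N where N: "b < real N * e"
      using reals_Archimedean3[OF e(1)] by blast
    show "\<forall>\<^sub>F n in sequentially. a < h n x"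
      unfolding eventually_sequentially
    proof (intro exI allI impI)
      fix n assume "N \<le> n"
      have "b \<le> h n x"
      proof (rule h_ge)
        fix y
        show "b \<le> g y + real n * dist x y"
        proof (cases "dist y x < e")
          case True
          then have "b < g y" by (rule e(2))
          then show ?thesis by (simp add: add_increasing2 less_imp_le)
        next
          case False
          then have "real N * e \<le> real n * dist x y"
            using \<open>N \<le> n\<close> e(1) by (intro mult_mono) (auto simp: dist_commute)
          then show ?thesis
            using N nonneg[of y] by linarith
        qed
      qed
      with b(1) show "a < h n x" by simp
    qed
  qed
  \<comment> \<open>The term of index 0 is \<open>h 0\<close> itself, so the first
    \<open>Suc n\<close> terms add up to exactly \<open>h n\<close>.\<close>
  define \<phi> where "\<phi> j = (\<lambda>x. h j x - (if j = 0 then 0 else h (j - 1) x))" for j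
  show thesis
  proof (rule that)
    show "continuous_on UNIV (\<phi> j)" for j
      unfolding \<phi>_def using h_cont by (cases "j = 0") (auto intro!: continuous_intros)
    show "0 \<le> \<phi> j x" for j x
      unfolding \<phi>_def using h_nonneg h_mono[of "j - 1" x] by (cases j) auto
    show "(\<lambda>j. \<phi> j x) sums g x" for x
    proof -
      have "(\<Sum>j<Suc n. \<phi> j x) = h n x" for n
        by (induction n) (auto simp: \<phi>_def)
      then have "(\<lambda>n. \<Sum>j<Suc n. \<phi> j x) \<longlonglongrightarrow> g x"
        using h_lim by simp
      then show ?thesis
        unfolding sums_def by (rule LIMSEQ_imp_Suc)
    qed
  qed
qed

text \<open>The two nonnegative series are subtracted term by term, and each difference is dominated
  by the sum of its two terms. The last conclusion supplies the boundedness of the single terms that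
  \<open>D_norm\<close> asks for.\<close>

lemma D_representation_of_real:
  fixes u v :: "'a::metric_space \<Rightarrow> real"
  assumes "lower_semicontinuous u" "lower_semicontinuous v"
    and "\<And>x. 0 \<le> u x" "\<And>x. 0 \<le> v x"
  obtains \<phi> :: "nat \<Rightarrow> 'a \<Rightarrow> complex" where "\<And>j. continuous_on UNIV (\<phi> j)"
    "\<And>x. (\<lambda>j. \<phi> j x) sums complex_of_real (u x - v x)"
    "\<And>x. (\<Sum>j. ennreal (norm (\<phi> j x))) \<le> ennreal (u x + v x)"
    "\<And>j x. norm (\<phi> j x) \<le> u x + v x"
proof -
  obtain a where a: "\<And>j. continuous_on UNIV (a j)" "\<And>j x. 0 \<le> a j x" "\<And>x. (\<lambda>j. a j x) sums u x"
    by (rule lower_semicontinuous_sums_continuous[OF assms(1,3)]) (rule that)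
  obtain b where b: "\<And>j. continuous_on UNIV (b j)" "\<And>j x. 0 \<le> b j x" "\<And>x. (\<lambda>j. b j x) sums v x"
    by (rule lower_semicontinuous_sums_continuous[OF assms(2,4)]) (rule that)
  have s: "(\<lambda>j. a j x + b j x) sums (u x + v x)" for x
    using a b by (intro sums_add)
  have le: "norm (complex_of_real (a j x - b j x)) \<le> a j x + b j x" for j x
    using a(2)[of j x] b(2)[of j x] by (simp add: norm_of_real del: of_real_diff)
  show thesis
  proof (rule that[of "\<lambda>j x. complex_of_real (a j x - b j x)"])
    show "continuous_on UNIV (\<lambda>x. complex_of_real (a j x - b j x))" for j
      using a b by (intro continuous_intros)
    show "(\<lambda>j. complex_of_real (a j x - b j x)) sums complex_of_real (u x - v x)" for x
      using a b by (intro sums_of_real sums_diff)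
    have "(\<Sum>j. ennreal (a j x + b j x)) = ennreal (u x + v x)" for x
      using a b s by (intro suminf_ennreal_eq) auto
    moreover have "(\<Sum>j. ennreal (norm (complex_of_real (a j x - b j x)))) \<le> (\<Sum>j. ennreal (a j x + b j x))" for x
      using le by (intro suminf_le ennreal_leI) auto
    ultimately show "(\<Sum>j. ennreal (norm (complex_of_real (a j x - b j x)))) \<le> ennreal (u x + v x)" for x
      by simp
    have "a j x + b j x \<le> u x + v x" for j x
    proof -
      have "(\<Sum>i\<in>{j}. a i x + b i x) \<le> (\<Sum>i. a i x + b i x)"
        using s[of x] a(2) b(2) by (intro sum_le_suminf) (auto simp: sums_iff)
      then show ?thesis
        using s[of x] by (simp add: sums_iff)
    qed
    with le show "norm (complex_of_real (a j x - b j x)) \<le> u x + v x" for j x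
      using order_trans by blast
  qed
qed

lemma D_norm_of_real_le:
  fixes u v :: "'a::metric_space \<Rightarrow> real"
  assumes "lower_semicontinuous u" "lower_semicontinuous v"
    and "\<And>x. 0 \<le> u x" "\<And>x. 0 \<le> v x"
    and bdd: "\<And>x. u x + v x \<le> B"
  shows "D_norm (\<lambda>x. complex_of_real (u x - v x)) \<le> (SUP x. ennreal (u x + v x))"
proof -
  obtain \<phi> :: "nat \<Rightarrow> 'a \<Rightarrow> complex" where \<phi>: "\<And>j. continuous_on UNIV (\<phi> j)"
    "\<And>x. (\<lambda>j. \<phi> j x) sums complex_of_real (u x - v x)"
    "\<And>x. (\<Sum>j. ennreal (norm (\<phi> j x))) \<le> ennreal (u x + v x)"
    "\<And>j x. norm (\<phi> j x) \<le> u x + v x"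
    by (rule D_representation_of_real[OF assms(1-4)]) (rule that)
  have bounded: "bounded (range (\<phi> j))" for j
    by (rule boundedI[of _ B]) (use \<phi>(4) bdd in \<open>auto intro: order_trans\<close>)
  have "D_norm (\<lambda>x. complex_of_real (u x - v x)) \<le> (SUP k. \<Sum>j. ennreal (norm (\<phi> j k)))"
    unfolding D_norm_def by (rule INF_lower) (use \<phi>(1,2) bounded in blast)
  also have "\<dots> \<le> (SUP x. ennreal (u x + v x))"
    by (rule SUP_mono') (rule \<phi>(3))
  finally show ?thesis .
qed

lemma D_space_of_real:
  fixes u v :: "'a::metric_space \<Rightarrow> real"
  assumes "lower_semicontinuous u" "lower_semicontinuous v"
    and "\<And>x. 0 \<le> u x" "\<And>x. 0 \<le> v x"
    and bdd: "\<And>x. u x + v x \<le> B"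
  shows "(\<lambda>x. complex_of_real (u x - v x)) \<in> D_space"
proof -
  obtain \<phi> :: "nat \<Rightarrow> 'a \<Rightarrow> complex" where \<phi>: "\<And>j. continuous_on UNIV (\<phi> j)"
    "\<And>x. (\<lambda>j. \<phi> j x) sums complex_of_real (u x - v x)"
    "\<And>x. (\<Sum>j. ennreal (norm (\<phi> j x))) \<le> ennreal (u x + v x)"
    by (rule D_representation_of_real[OF assms(1-4)]) (rule that)
  have "(SUP k. \<Sum>j. ennreal (norm (\<phi> j k))) \<le> ennreal B"
    using \<phi>(3) bdd by (intro SUP_least) (meson ennreal_leI order_trans)
  then have "(SUP k. \<Sum>j. ennreal (norm (\<phi> j k))) < \<infinity>"
    by (rule le_less_trans) simp
  with \<phi>(1,2) show ?thesis
    unfolding D_space_def by blast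
qed

text \<open>Applied with \<open>c = \<i>\<close> to reassemble a complex function from its real and
  imaginary parts.\<close>

lemma D_space_add_mult:
  assumes "f \<in> D_space" "g \<in> D_space"
  shows "(\<lambda>x. f x + c * g x) \<in> D_space"
proof -
  obtain \<phi> where \<phi>: "\<And>j. continuous_on UNIV (\<phi> j)" "(SUP k. \<Sum>j. ennreal (norm (\<phi> j k))) < \<infinity>"
    "\<And>k. (\<lambda>j. \<phi> j k) sums f k"
    using assms(1) unfolding D_space_def by blast
  obtain \<psi> where \<psi>: "\<And>j. continuous_on UNIV (\<psi> j)" "(SUP k. \<Sum>j. ennreal (norm (\<psi> j k))) < \<infinity>"
    "\<And>k. (\<lambda>j. \<psi> j k) sums g k"
    using assms(2) unfolding D_space_def by blast
  let ?\<theta> = "\<lambda>j x. \<phi> j x + c * \<psi> j x"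
  have bound: "(\<Sum>j. ennreal (norm (?\<theta> j k))) \<le> (SUP k. \<Sum>j. ennreal (norm (\<phi> j k)))
      + ennreal (norm c) * (SUP k. \<Sum>j. ennreal (norm (\<psi> j k)))" for k
  proof -
    have "(\<Sum>j. ennreal (norm (?\<theta> j k)))
      \<le> (\<Sum>j. ennreal (norm (\<phi> j k)) + ennreal (norm c) * ennreal (norm (\<psi> j k)))"
      by (intro suminf_le)
        (auto simp: ennreal_mult[symmetric] ennreal_plus[symmetric] norm_mult[symmetric]
          simp del: ennreal_plus intro!: ennreal_leI norm_triangle_ineq)
    also have "\<dots> = (\<Sum>j. ennreal (norm (\<phi> j k))) + ennreal (norm c) * (\<Sum>j. ennreal (norm (\<psi> j k)))"
      by (subst suminf_add[symmetric]) auto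
    also have "\<dots> \<le> (SUP k. \<Sum>j. ennreal (norm (\<phi> j k)))
      + ennreal (norm c) * (SUP k. \<Sum>j. ennreal (norm (\<psi> j k)))"
      by (intro add_mono mult_left_mono SUP_upper) auto
    finally show ?thesis .
  qed
  have "(SUP k. \<Sum>j. ennreal (norm (?\<theta> j k))) \<le> (SUP k. \<Sum>j. ennreal (norm (\<phi> j k)))
      + ennreal (norm c) * (SUP k. \<Sum>j. ennreal (norm (\<psi> j k)))"
    by (intro SUP_least bound)
  also have "\<dots> < \<infinity>"
    using \<phi>(2) \<psi>(2) ennreal_less_top[of "norm c"]
    unfolding infinity_ennreal_def ennreal_add_less_top ennreal_mult_less_top by blast
  finally have "(SUP k. \<Sum>j. ennreal (norm (?\<theta> j k))) < \<infinity>" .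
  moreover have "continuous_on UNIV (?\<theta> j)" for j
    using \<phi>(1) \<psi>(1) by (intro continuous_intros)
  moreover have "(\<lambda>j. ?\<theta> j k) sums (f k + c * g k)" for k
    using \<phi>(3) \<psi>(3) by (intro sums_add sums_mult)
  ultimately show ?thesis
    unfolding D_space_def mem_Collect_eq by (intro exI[of _ ?\<theta>] conjI allI)
qed

section \<open>The stable oscillation\<close>

text \<open>Stability turns \<open>osc_osuc_ge\<close> into the supersolution inequality for
  \<open>osc f \<tau>\<close> itself. The increment of \<open>f\<close> dominates that of
  \<open>l\<close>, so \<open>osc f \<tau>\<close> minus \<open>l\<close> of \<open>f\<close> is
  upper semicontinuous. The parameter \<open>l\<close> stands for plus or minus \<open>Re\<close> or
  \<open>Im\<close>.\<close>

lemma stable_osc_lower_semicontinuous: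
  fixes l :: "complex \<Rightarrow> real"
  assumes stable: "osc f \<tau> = osc f (osuc \<tau>)"
    and fin: "\<And>x. osc f \<tau> x < \<infinity>"
    and l: "\<And>z z'. l z - l z' \<le> norm (z - z')"
  shows "lower_semicontinuous (\<lambda>x. (c - enn2real (osc f \<tau> x) + l (f x)) / 2)"
proof (rule lower_semicontinuousI)
  fix x and e :: real assume "e > 0"
  define w where "w x = enn2real (osc f \<tau> x)" for x
  have w: "osc f \<tau> x = ennreal (w x)" "0 \<le> w x" for x
    using fin[of x] by (auto simp: w_def ennreal_enn2real_if)
  have "osc f \<tau> x < ennreal (w x + e)"
    using \<open>e > 0\<close> w(2)[of x] by (simp add: w(1) ennreal_less_iff)
  moreover have "upper_lim x (\<lambda>y. ennreal (norm (f y - f x)) + osc f \<tau> y) \<le> osc f \<tau> x"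
    using osc_osuc_ge[of x f \<tau>] stable by simp
  ultimately have "\<forall>\<^sub>F y in nhds x. ennreal (norm (f y - f x)) + osc f \<tau> y < ennreal (w x + e)"
    by (simp add: upper_lim_le_iff)
  then have "\<forall>\<^sub>F y in nhds x. (c - w x + l (f x)) / 2 < (c - w y + l (f y)) / 2 + e"
  proof eventually_elim
    case (elim y)
    then have "norm (f y - f x) + w y < w x + e"
      using w(2)[of y]
      by (simp add: w(1) ennreal_plus[symmetric] ennreal_less_iff del: ennreal_plus)
    with l[of "f x" "f y"] \<open>e > 0\<close> show ?case
      by (simp add: norm_minus_commute field_simps)
  qed
  then show "\<forall>\<^sub>F y in nhds x. (c - enn2real (osc f \<tau> x) + l (f x)) / 2
      < (c - enn2real (osc f \<tau> y) + l (f y)) / 2 + e"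
    by (simp add: w_def)
qed

lemma D_space_nonexpansive_image:
  fixes f :: "'a::metric_space \<Rightarrow> complex" and l :: "complex \<Rightarrow> real"
  assumes stable: "osc f \<tau> = osc f (osuc \<tau>)"
    and osc: "\<And>x. osc f \<tau> x \<le> ennreal C"
    and l: "\<And>z z'. \<bar>l z - l z'\<bar> \<le> norm (z - z')"
    and f: "\<And>x. \<bar>l (f x)\<bar> \<le> B"
  shows "(\<lambda>x. complex_of_real (l (f x))) \<in> D_space"
proof -
  \<comment> \<open>Large enough that \<open>c - w\<close> dominates the absolute value of
    \<open>l (f x)\<close>. A negative \<open>C\<close> gives \<open>ennreal C = 0\<close>, hence
    \<open>max 0 C\<close>.\<close>
  define c where "c = max 0 C + B"
  define w where "w x = enn2real (osc f \<tau> x)" for x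
  have fin: "osc f \<tau> x < \<infinity>" for x
    by (rule le_less_trans[OF osc]) simp
  have w: "0 \<le> w x" "w x \<le> max 0 C" for x
    using order_trans[OF osc[of x] ennreal_leI[of C "max 0 C"]]
    by (auto simp: w_def intro!: enn2real_leI)
  let ?u = "\<lambda>x. (c - w x + l (f x)) / 2" and ?v = "\<lambda>x. (c - w x - l (f x)) / 2"
  have "lower_semicontinuous ?u"
    unfolding w_def using l
    by (intro stable_osc_lower_semicontinuous[OF stable fin]) (auto simp: abs_le_iff)
  moreover have "lower_semicontinuous (\<lambda>x. (c - w x + - l (f x)) / 2)"
    unfolding w_def using l
    by (intro stable_osc_lower_semicontinuous[OF stable fin, of "\<lambda>z. - l z"]) (simp add: abs_le_iff)
  then have "lower_semicontinuous ?v" by simp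
  moreover have "0 \<le> ?u x" "0 \<le> ?v x" "?u x + ?v x \<le> c" for x
    using w[of x] f[of x] by (auto simp: c_def field_simps)
  ultimately have "(\<lambda>x. complex_of_real (?u x - ?v x)) \<in> D_space"
    by (rule D_space_of_real)
  then show ?thesis
    by (simp add: diff_divide_distrib add_divide_distrib)
qed

text \<open>\<open>Re\<close> and \<open>Im\<close> are nonexpansive, so the oscillation of
  \<open>f\<close> itself serves for both parts and need not be compared with theirs.\<close>

lemma D_space_if_osc_bounded:
  fixes f :: "'a::metric_space \<Rightarrow> complex"
  assumes stable: "osc f \<tau> = osc f (osuc \<tau>)"
    and osc: "\<And>x. osc f \<tau> x \<le> ennreal C"
    and bdd: "bounded (range f)"
  shows "f \<in> D_space"
proof -
  obtain B where B: "norm (f x) \<le> B" for x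
    using bdd by (auto simp: bounded_iff)
  have "(\<lambda>x. complex_of_real (Re (f x))) \<in> D_space"
    by (rule D_space_nonexpansive_image[OF stable osc, of Re B])
      (metis abs_Re_le_cmod minus_complex.sel(1), metis abs_Re_le_cmod B order_trans)
  moreover have "(\<lambda>x. complex_of_real (Im (f x))) \<in> D_space"
    by (rule D_space_nonexpansive_image[OF stable osc, of Im B])
      (metis abs_Im_le_cmod minus_complex.sel(2), metis abs_Im_le_cmod B order_trans)
  ultimately have "(\<lambda>x. complex_of_real (Re (f x)) + \<i> * complex_of_real (Im (f x))) \<in> D_space"
    by (rule D_space_add_mult)
  then show ?thesis
    by (simp add: complex_eq[symmetric])
qed

lemma D_space_osc_bounded:
  fixes f :: "'a::t2_space \<Rightarrow> complex"
  assumes "f \<in> D_space"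
  obtains C :: real where "\<And>\<beta> x. ennreal (norm (f x)) + osc f \<beta> x \<le> ennreal C"
proof -
  obtain \<phi> where \<phi>: "\<And>j. continuous_on UNIV (\<phi> j)" "(SUP k. \<Sum>j. ennreal (norm (\<phi> j k))) < \<infinity>"
    "\<And>k. (\<lambda>j. \<phi> j k) sums f k"
    using assms unfolding D_space_def by blast
  let ?S = "SUP k. \<Sum>j. ennreal (norm (\<phi> j k))"
  have S: "ennreal (enn2real ?S) = ?S"
    using \<phi>(2) unfolding infinity_ennreal_def by (rule ennreal_enn2real)
  show thesis
    by (rule that[of "enn2real ?S"], unfold S) (rule osc_le_sum_norm[OF \<phi>(1,3)])
qed

theorem theorem3p5:
  fixes f :: "'a::metric_space \<Rightarrow> complex"
  assumes "separable_space (euclidean :: 'a topology)"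
    and "bounded (range f)"
  shows "(\<exists>\<alpha>. \<forall>\<beta>>\<alpha>. osc f \<alpha> = osc f \<beta>) \<and>
    (let \<tau> = (LEAST \<alpha>. \<forall>\<beta>>\<alpha>. osc f \<alpha> = osc f \<beta>) in
      (f \<in> D_space \<longleftrightarrow> (\<exists>C::real. \<forall>x. osc f \<tau> x \<le> ennreal C)) \<and>
      (range f \<subseteq> \<real> \<and> f \<in> D_space \<longrightarrow>
        D_norm f = (SUP x. ennreal (norm (f x)) + osc f \<tau> x) \<and>
        (let c = enn2real (SUP x. ennreal (norm (f x)) + osc f \<tau> x);
             u = (\<lambda>x. (c - enn2real (osc f \<tau> x) + Re (f x)) / 2);
             v = (\<lambda>x. (c - enn2real (osc f \<tau> x) - Re (f x)) / 2)
         in (\<forall>x. 0 \<le> u x) \<and> (\<forall>x. 0 \<le> v x) \<and>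
            lower_semicontinuous u \<and> lower_semicontinuous v \<and>
            (\<forall>x. f x = complex_of_real (u x - v x)) \<and>
            D_norm f = (SUP x. ennreal (norm (u x + v x))))))"
proof -
  let ?stable = "\<lambda>\<alpha>. \<forall>\<beta>>\<alpha>. osc f \<alpha> = osc f \<beta>"
  obtain \<alpha> where "\<And>\<beta>. \<alpha> \<le> \<beta> \<Longrightarrow> osc f \<alpha> = osc f \<beta>"
    using increasing_usc_stabilizes[of "osc f", OF assms(1) osc_mono upper_lim_osc] by blast
  then have ex: "?stable \<alpha>"
    by (simp add: less_imp_le)
  define \<tau> where "\<tau> = (LEAST \<alpha>. ?stable \<alpha>)"
  have "?stable \<tau>"
    unfolding \<tau>_def using ex by (rule LeastI)
  \<comment> \<open>From here on, stability enters only through this one equation.\<close>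
  then have stable: "osc f \<tau> = osc f (osuc \<tau>)"
    by simp
  have iff: "f \<in> D_space \<longleftrightarrow> (\<exists>C::real. \<forall>x. osc f \<tau> x \<le> ennreal C)"
  proof
    assume "f \<in> D_space"
    then obtain C where C: "\<And>\<beta> x. ennreal (norm (f x)) + osc f \<beta> x \<le> ennreal C"
      by (rule D_space_osc_bounded) (rule that)
    have "osc f \<tau> x \<le> ennreal C" for x
      by (intro order_trans[OF _ C[of x \<tau>]]) (simp add: add_increasing)
    then show "\<exists>C::real. \<forall>x. osc f \<tau> x \<le> ennreal C" by blast
  next
    assume "\<exists>C::real. \<forall>x. osc f \<tau> x \<le> ennreal C"
    then show "f \<in> D_space"
      using D_space_if_osc_bounded[OF stable _ assms(2)] by blast
  qed
  define \<Lambda> where "\<Lambda> = (SUP x. ennreal (norm (f x)) + osc f \<tau> x)"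
  define c where "c = enn2real \<Lambda>"
  define w where "w x = enn2real (osc f \<tau> x)" for x
  define u where "u x = (c - w x + Re (f x)) / 2" for x
  define v where "v x = (c - w x - Re (f x)) / 2" for x
  have real: "D_norm f = \<Lambda> \<and> (\<forall>x. 0 \<le> u x) \<and> (\<forall>x. 0 \<le> v x) \<and>
      lower_semicontinuous u \<and> lower_semicontinuous v \<and>
      (\<forall>x. f x = complex_of_real (u x - v x)) \<and> D_norm f = (SUP x. ennreal (norm (u x + v x)))"
    if real_valued: "range f \<subseteq> \<real>" and D: "f \<in> D_space"
  proof -
    obtain C where C: "\<And>\<beta> x. ennreal (norm (f x)) + osc f \<beta> x \<le> ennreal C"
      by (rule D_space_osc_bounded[OF D]) (rule that)
    have "\<Lambda> \<le> ennreal C"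
      unfolding \<Lambda>_def by (intro SUP_least C)
    \<comment> \<open>Finiteness matters here: \<open>enn2real\<close> sends infinity to 0.\<close>
    then have \<Lambda>: "\<Lambda> = ennreal c"
      unfolding c_def by (metis ennreal_enn2real_if ennreal_neq_top neq_top_trans)
    have le: "ennreal (norm (f x)) + osc f \<tau> x \<le> ennreal c" for x
      unfolding \<Lambda>[symmetric] \<Lambda>_def by (rule SUP_upper) simp
    have fin: "osc f \<tau> x < \<infinity>" for x
    proof -
      have "osc f \<tau> x \<le> ennreal (norm (f x)) + osc f \<tau> x"
        by (simp add: add_increasing)
      also have "\<dots> \<le> ennreal c" by (rule le)
      finally show ?thesis by (rule le_less_trans) simp
    qed
    have w: "osc f \<tau> x = ennreal (w x)" "0 \<le> w x" for x
      using fin[of x] by (auto simp: w_def ennreal_enn2real_if)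
    have c_nonneg: "0 \<le> c" by (simp add: c_def)
    have le': "norm (f x) + w x \<le> c" for x
      using le[of x] w(2)[of x] c_nonneg by (simp add: w(1) ennreal_plus[symmetric] del: ennreal_plus)
    \<comment> \<open>By \<open>le'\<close>, \<open>c - w x\<close> is at least
      \<open>norm (f x)\<close> and hence dominates \<open>Re (f x)\<close> with either
      sign.\<close>
    have uv: "0 \<le> u x" "0 \<le> v x" for x
      using le'[of x] abs_Re_le_cmod[of "f x"] by (auto simp: u_def v_def)
    have uv_sum: "u x + v x = c - w x" for x
      by (simp add: u_def v_def field_simps)
    have uv_le: "u x + v x \<le> c" for x
      using w(2)[of x] by (simp add: uv_sum)
    have f_eq: "f x = complex_of_real (u x - v x)" for x
    proof -
      have "f x \<in> \<real>" using real_valued by blast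
      moreover have "u x - v x = Re (f x)" by (simp add: u_def v_def field_simps)
      ultimately show ?thesis by (simp add: of_real_Re)
    qed
    have lsc_u: "lower_semicontinuous u"
      unfolding u_def w_def
      by (rule stable_osc_lower_semicontinuous[OF stable fin])
        (metis abs_Re_le_cmod abs_le_D1 minus_complex.sel(1))
    have "lower_semicontinuous (\<lambda>x. (c - w x + - Re (f x)) / 2)"
      unfolding w_def
    proof (rule stable_osc_lower_semicontinuous[OF stable fin, of "\<lambda>z. - Re z"])
      fix z z' show "- Re z - - Re z' \<le> norm (z - z')"
        using abs_Re_le_cmod[of "z - z'"] by simp
    qed
    then have lsc_v: "lower_semicontinuous v"
      unfolding v_def by simp
    \<comment> \<open>The cycle from \<open>D_norm f\<close> through the supremum of
      \<open>u + v\<close> and \<open>\<Lambda>\<close> back to \<open>D_norm f\<close> forces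
      equality throughout. In particular \<open>c - w\<close> has supremum \<open>c\<close>, which
      is not evident directly.\<close>
    have "D_norm f \<le> (SUP x. ennreal (u x + v x))"
      using D_norm_of_real_le[OF lsc_u lsc_v uv uv_le] by (simp add: f_eq[symmetric] del: of_real_diff)
    moreover have "(SUP x. ennreal (u x + v x)) \<le> \<Lambda>"
      unfolding \<Lambda> using uv_le by (intro SUP_least ennreal_leI)
    moreover have "\<Lambda> \<le> D_norm f"
      unfolding \<Lambda>_def by (intro SUP_least osc_le_D_norm)
    moreover have "norm (u x + v x) = u x + v x" for x
      using uv[of x] by simp
    ultimately show ?thesis
      using uv f_eq lsc_u lsc_v by auto
  qed
  show ?thesis
    unfolding Let_def \<tau>_def[symmetric] \<Lambda>_def[symmetric] c_def[symmetric]
      w_def[symmetric] u_def[symmetric] v_def[symmetric]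
    using ex iff real by blast
qed

end
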